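(* Let $p$ be an odd prime, $k\ge 1$ an integer, $m\in\mathbb{Z}_{p^k}$, and $t=v_p(m)$. Let $$a_{p^k}(m)=|\{q\in \mathcal{H}_{\mathbb{Z}_{p^k}}: N(q)=m\}|,$$ i.e. $a_{p^k}(m)$ is the number of quadruples $(x_1,x_2,x_3,x_4)\in\mathbb{Z}_{p^k}^4$ satisfying $$m=x_1^2+x_2^2+x_3^2+x_4^2 .$$ Then $$a_{p^k}(m)=\begin{cases} p^{3k-2}(p^2-1), & t=0,\\ p^{3k-2-t}(p+1)(p^{t+1}-1), & 0<t<k,\\ p^{2k-1}(p^{k+1}+p^k-1), & t=k.\end{cases}$$
   Context: $\mathbb{Z}_{p^k}=\mathbb{Z}/p^k\mathbb{Z}$. For a commutative unital ring $R$, $\mathcal{H}_R=\{w+xi+yj+zk: w,x,y,z\in R\}$ is the quaternion ring over $R$ (free $R$-module on $1,i,j,k$ with $i^2=j^2=k^2=ijk=-1$), and the norm map $N:\mathcal{H}_R\to R$ is $N(w+xi+yj+zk)=w^2+x^2+y^2+z^2$. The $p$-adic valuation $v_p$ on $\mathbb{Z}_{p^k}$ is defined as follows: for $m\neq 0$ with integer representative $a\in\{1,\dots,p^k-1\}$, $v_p(m)=\max\{t\ge 0: p^t\mid a\}$, and $v_p(0)=k$. *)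

theory Defs
  imports "HOL-Number_Theory.Residues"
begin

datatype 'a quat = Quat (qre: 'a) (qi: 'a) (qj: 'a) (qk: 'a)

text \<open>\<open>Quat w x y z\<close> stands for \<open>w + xi + yj + zk\<close>; the multiplication is the bilinear
  extension of \<open>i\<^sup>2 = j\<^sup>2 = k\<^sup>2 = ijk = -1\<close>.\<close>

definition quat_ring :: "('a, 'b) ring_scheme \<Rightarrow> 'a quat ring" where
  "quat_ring R =
    \<lparr>carrier = {Quat w x y z | w x y z.
       w \<in> carrier R \<and> x \<in> carrier R \<and> y \<in> carrier R \<and> z \<in> carrier R},
     monoid.mult = (\<lambda>p q.
       Quat (qre p \<otimes>\<^bsub>R\<^esub> qre q \<ominus>\<^bsub>R\<^esub> qi p \<otimes>\<^bsub>R\<^esub> qi q \<ominus>\<^bsub>R\<^esub> qj p \<otimes>\<^bsub>R\<^esub> qj q \<ominus>\<^bsub>R\<^esub> qk p \<otimes>\<^bsub>R\<^esub> qk q)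
            (qre p \<otimes>\<^bsub>R\<^esub> qi q \<oplus>\<^bsub>R\<^esub> qi p \<otimes>\<^bsub>R\<^esub> qre q \<oplus>\<^bsub>R\<^esub> qj p \<otimes>\<^bsub>R\<^esub> qk q \<ominus>\<^bsub>R\<^esub> qk p \<otimes>\<^bsub>R\<^esub> qj q)
            (qre p \<otimes>\<^bsub>R\<^esub> qj q \<ominus>\<^bsub>R\<^esub> qi p \<otimes>\<^bsub>R\<^esub> qk q \<oplus>\<^bsub>R\<^esub> qj p \<otimes>\<^bsub>R\<^esub> qre q \<oplus>\<^bsub>R\<^esub> qk p \<otimes>\<^bsub>R\<^esub> qi q)
            (qre p \<otimes>\<^bsub>R\<^esub> qk q \<oplus>\<^bsub>R\<^esub> qi p \<otimes>\<^bsub>R\<^esub> qj q \<ominus>\<^bsub>R\<^esub> qj p \<otimes>\<^bsub>R\<^esub> qi q \<oplus>\<^bsub>R\<^esub> qk p \<otimes>\<^bsub>R\<^esub> qre q)),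
     one = Quat \<one>\<^bsub>R\<^esub> \<zero>\<^bsub>R\<^esub> \<zero>\<^bsub>R\<^esub> \<zero>\<^bsub>R\<^esub>,
     zero = Quat \<zero>\<^bsub>R\<^esub> \<zero>\<^bsub>R\<^esub> \<zero>\<^bsub>R\<^esub> \<zero>\<^bsub>R\<^esub>,
     add = (\<lambda>p q. Quat (qre p \<oplus>\<^bsub>R\<^esub> qre q) (qi p \<oplus>\<^bsub>R\<^esub> qi q) (qj p \<oplus>\<^bsub>R\<^esub> qj q) (qk p \<oplus>\<^bsub>R\<^esub> qk q))\<rparr>"

definition quat_norm :: "('a, 'b) ring_scheme \<Rightarrow> 'a quat \<Rightarrow> 'a" where
  "quat_norm R q =
    qre q [^]\<^bsub>R\<^esub> (2::nat) \<oplus>\<^bsub>R\<^esub> qi q [^]\<^bsub>R\<^esub> (2::nat) \<oplus>\<^bsub>R\<^esub> qj q [^]\<^bsub>R\<^esub> (2::nat) \<oplus>\<^bsub>R\<^esub> qk q [^]\<^bsub>R\<^esub> (2::nat)"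

lemma quat_in_carrier_iff [simp]:
  "Quat w x y z \<in> carrier (quat_ring R) \<longleftrightarrow>
    w \<in> carrier R \<and> x \<in> carrier R \<and> y \<in> carrier R \<and> z \<in> carrier R"
  by (simp add: quat_ring_def)

lemma (in cring) quat_ring_is_ring: "ring (quat_ring R)"
proof (rule ringI)
  show "abelian_group (quat_ring R)"
  proof (rule abelian_groupI)
    fix x assume "x \<in> carrier (quat_ring R)"
    then obtain a b c d where "x = Quat a b c d" "a \<in> carrier R" "b \<in> carrier R" "c \<in> carrier R" "d \<in> carrier R"
      by (cases x) simp
    then show "\<exists>y\<in>carrier (quat_ring R). y \<oplus>\<^bsub>quat_ring R\<^esub> x = \<zero>\<^bsub>quat_ring R\<^esub>"
      by (intro bexI[of _ "Quat (\<ominus> a) (\<ominus> b) (\<ominus> c) (\<ominus> d)"]) (auto simp: quat_ring_def l_neg)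
  qed (auto simp: quat_ring_def a_ac)
  show "monoid (quat_ring R)"
  proof (rule monoidI)
    fix x y z
    assume "x \<in> carrier (quat_ring R)" "y \<in> carrier (quat_ring R)" "z \<in> carrier (quat_ring R)"
    then show "x \<otimes>\<^bsub>quat_ring R\<^esub> y \<otimes>\<^bsub>quat_ring R\<^esub> z = x \<otimes>\<^bsub>quat_ring R\<^esub> (y \<otimes>\<^bsub>quat_ring R\<^esub> z)"
      by (cases x; cases y; cases z)
         (auto simp: quat_ring_def minus_eq l_distr r_distr minus_add l_minus r_minus m_assoc a_ac)
  qed (auto simp: quat_ring_def minus_eq l_minus r_minus)
next
  fix x y z
  assume "x \<in> carrier (quat_ring R)" "y \<in> carrier (quat_ring R)" "z \<in> carrier (quat_ring R)"
  then show "(x \<oplus>\<^bsub>quat_ring R\<^esub> y) \<otimes>\<^bsub>quat_ring R\<^esub> z = x \<otimes>\<^bsub>quat_ring R\<^esub> z \<oplus>\<^bsub>quat_ring R\<^esub> y \<otimes>\<^bsub>quat_ring R\<^esub> z"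
   and "z \<otimes>\<^bsub>quat_ring R\<^esub> (x \<oplus>\<^bsub>quat_ring R\<^esub> y) = z \<otimes>\<^bsub>quat_ring R\<^esub> x \<oplus>\<^bsub>quat_ring R\<^esub> z \<otimes>\<^bsub>quat_ring R\<^esub> y"
    by (cases x; cases y; cases z;
        auto simp: quat_ring_def minus_eq l_distr r_distr minus_add l_minus r_minus a_ac)+
qed

lemma (in cring) quat_ring_relations:
  defines "i \<equiv> Quat \<zero> \<one> \<zero> \<zero>" and "j \<equiv> Quat \<zero> \<zero> \<one> \<zero>" and "k \<equiv> Quat \<zero> \<zero> \<zero> \<one>"
    and "m \<equiv> Quat (\<ominus> \<one>) \<zero> \<zero> \<zero>"
  shows "i \<otimes>\<^bsub>quat_ring R\<^esub> i = m" "j \<otimes>\<^bsub>quat_ring R\<^esub> j = m" "k \<otimes>\<^bsub>quat_ring R\<^esub> k = m"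
    "i \<otimes>\<^bsub>quat_ring R\<^esub> j \<otimes>\<^bsub>quat_ring R\<^esub> k = m"
  by (simp_all add: assms quat_ring_def minus_eq)

text \<open>The elements of \<open>residue_ring (p ^ k)\<close> are the integer representatives
  \<open>0, \<dots>, p ^ k - 1\<close>.\<close>

definition residue_val :: "nat \<Rightarrow> nat \<Rightarrow> int \<Rightarrow> nat" where
  "residue_val p k m = (if m = 0 then k else multiplicity (int p) m)"

definition num_quat_norm :: "nat \<Rightarrow> nat \<Rightarrow> int \<Rightarrow> nat" where
  "num_quat_norm p k m =
    (let R = residue_ring (int p ^ k) in card {q \<in> carrier (quat_ring R). quat_norm R q = m})"

lemma num_quat_norm_eq_card_quadruples:
  "num_quat_norm p k m =
    (let R = residue_ring (int p ^ k) in
     card {(x1, x2, x3, x4).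
       x1 \<in> carrier R \<and> x2 \<in> carrier R \<and> x3 \<in> carrier R \<and> x4 \<in> carrier R \<and>
       m = x1 [^]\<^bsub>R\<^esub> (2::nat) \<oplus>\<^bsub>R\<^esub> x2 [^]\<^bsub>R\<^esub> (2::nat) \<oplus>\<^bsub>R\<^esub> x3 [^]\<^bsub>R\<^esub> (2::nat) \<oplus>\<^bsub>R\<^esub> x4 [^]\<^bsub>R\<^esub> (2::nat)})"
  unfolding num_quat_norm_def Let_def
  by (rule bij_betw_same_card[of "\<lambda>q. (qre q, qi q, qj q, qk q)"],
      rule bij_betw_byWitness[of _ "\<lambda>(w, x, y, z). Quat w x y z"])
     (auto simp: quat_norm_def quat_ring_def)

end

(* Since p is odd, there are a, b with a^2 + b^2 = -1 mod p^k (pigeonhole mod p, then Hensel lifting).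
   Then z^2 + w^2 = -(u^2 + v^2) with u = a z - b w, v = a w + b z, so an invertible linear
   substitution turns the sum of four squares into the split form x y + z w.
   For fixed x, z with g = gcd(x, z, p^k), the congruence x y + z w = m has p^k g solutions (y, w)
   if g divides m and none otherwise; summing over g = p^s gives a geometric sum. *)

theory Submission
  imports Defs
begin

section \<open>Minus one as a sum of two squares modulo \<open>p ^ k\<close>\<close>

text \<open>Pigeonhole: for \<open>x\<close>, \<open>y\<close> in \<open>{0..h}\<close> with
  \<open>p = 2 * h + 1\<close>, the squares \<open>x\<^sup>2\<close> and the numbers
  \<open>-1 - y\<^sup>2\<close> each take \<open>h + 1\<close> distinct residues. Disjoint value
  sets would give \<open>p + 1\<close> residues modulo \<open>p\<close>.\<close>

lemma square_sum_minus_one_mod_prime: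
  fixes p :: nat
  assumes "prime p" "odd p"
  shows "\<exists>a b :: int. int p dvd a\<^sup>2 + b\<^sup>2 + 1"
proof (rule ccontr)
  assume none: "\<not> ?thesis"
  define h where "h = (int p - 1) div 2"
  have p: "int p = 2 * h + 1" and h: "h \<ge> 0"
    using assms prime_gt_0_nat[of p] by (auto simp: h_def elim!: oddE)
  \<comment> \<open>On this half range both \<open>x - y\<close> and \<open>x + y\<close> are
    smaller than \<open>p\<close> in absolute value, so the one divisible by \<open>p\<close>
    vanishes; a vanishing sum of nonnegative numbers forces \<open>x = y = 0\<close>.\<close>
  have inj: "x = y" if "x \<in> {0..h}" "y \<in> {0..h}" "int p dvd x\<^sup>2 - y\<^sup>2" for x y
  proof -
    have "int p dvd (x - y) * (x + y)"
      using that(3) by (simp add: power2_eq_square algebra_simps)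
    then have "int p dvd x - y \<or> int p dvd x + y"
      using assms(1) by (simp add: prime_dvd_mult_iff)
    moreover have "\<bar>x - y\<bar> < int p" "\<bar>x + y\<bar> < int p"
      using that p by auto
    ultimately have "x - y = 0 \<or> x + y = 0"
      using zdvd_not_zless dvd_imp_le_int by (metis linorder_not_less abs_of_nat)
    then show ?thesis using that by auto
  qed
  define f g where "f = (\<lambda>x. x\<^sup>2 mod int p)" and "g = (\<lambda>x. (-1 - x\<^sup>2) mod int p)"
  have "inj_on f {0..h}"
    unfolding f_def by (intro inj_onI inj) (auto simp: mod_eq_dvd_iff)
  moreover have "inj_on g {0..h}"
  proof (intro inj_onI inj)
    fix x y assume "g x = g y"
    then have "int p dvd y\<^sup>2 - x\<^sup>2" by (simp add: g_def mod_eq_dvd_iff)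
    then show "int p dvd x\<^sup>2 - y\<^sup>2" by (simp add: dvd_diff_commute)
  qed auto
  moreover have "f ` {0..h} \<inter> g ` {0..h} = {}"
  proof -
    have "f x \<noteq> g y" for x y
    proof
      assume "f x = g y"
      then have "int p dvd x\<^sup>2 - (-1 - y\<^sup>2)" by (simp add: f_def g_def mod_eq_dvd_iff)
      then show False using none by (auto simp: algebra_simps)
    qed
    then show ?thesis by auto
  qed
  ultimately have "card (f ` {0..h} \<union> g ` {0..h}) = nat (h + 1) + nat (h + 1)"
    by (simp add: card_Un_disjoint card_image)
  moreover have "card (f ` {0..h} \<union> g ` {0..h}) \<le> card {0..<int p}"
    using prime_gt_0_nat[OF assms(1)] by (intro card_mono) (auto simp: f_def g_def)
  ultimately show False using p h by auto
qed

text \<open>Hensel lifting with \<open>b\<close> kept fixed: replacing \<open>a\<close> by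
  \<open>a + p ^ k * s\<close> leaves a linear congruence for \<open>s\<close> modulo
  \<open>p\<close>, whose coefficient \<open>2 * a\<close> is a unit. The induction starts at
  \<open>k = 1\<close>, since a unit among \<open>a\<close>, \<open>b\<close> can only be found once
  \<open>p\<close> divides \<open>a\<^sup>2 + b\<^sup>2 + 1\<close>.\<close>

lemma square_sum_minus_one_mod_prime_power:
  fixes p k :: nat
  assumes "prime p" "odd p"
  shows "\<exists>a b :: int. int p ^ k dvd a\<^sup>2 + b\<^sup>2 + 1"
proof (cases "k = 0")
  case False
  then have "k \<ge> 1" by simp
  then show ?thesis
  proof (induction k rule: nat_induct_at_least)
    case base
    then show ?case using square_sum_minus_one_mod_prime[OF assms] by simp
  next
    case (Suc k)
    have p: "prime (int p)" using assms by simp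
    \<comment> \<open>If \<open>p\<close> divided both \<open>a\<close> and \<open>b\<close>, it
      would divide 1; by symmetry the two may be swapped so that \<open>a\<close> is the
      unit.\<close>
    obtain a b :: int where ab: "int p ^ k dvd a\<^sup>2 + b\<^sup>2 + 1" and a: "\<not> int p dvd a"
    proof -
      obtain a b :: int where ab: "int p ^ k dvd a\<^sup>2 + b\<^sup>2 + 1"
        using Suc.IH by blast
      then have "int p dvd a\<^sup>2 + b\<^sup>2 + 1"
        using Suc.hyps dvd_trans[of "int p" "int p ^ k"] by (simp add: dvd_power)
      then have "\<not> (int p dvd a \<and> int p dvd b)"
        using p not_prime_unit dvd_add_right_iff[of "int p" "a\<^sup>2 + b\<^sup>2" 1]
        by (auto simp: power2_eq_square)
      then show thesis using that ab by (metis add.commute)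
    qed
    from ab obtain c where c: "a\<^sup>2 + b\<^sup>2 + 1 = int p ^ k * c" by (elim dvdE)
    have "coprime a (int p)"
      using p a prime_imp_coprime coprime_commute by blast
    then have "coprime (2 * a) (int p)"
      using assms(2) by simp
    \<comment> \<open>As \<open>r\<close> inverts \<open>2 * a\<close>, the choice
      \<open>s = - c * r\<close> makes \<open>c + 2 * a * s\<close> divisible by \<open>p\<close>,
      which supplies the extra factor \<open>p\<close> next to \<open>p ^ k\<close>.\<close>
    then obtain r where "[2 * a * r = 1] (mod int p)"
      using cong_solve_coprime_int by blast
    then have "int p dvd 2 * a * r - 1" by (simp add: cong_iff_dvd_diff)
    then have "int p dvd - (c * (2 * a * r - 1))" by simp
    then have s: "int p dvd c + 2 * a * (- c * r)" by (simp add: algebra_simps)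
    define s where "s = - c * r"
    have "(a + int p ^ k * s)\<^sup>2 + b\<^sup>2 + 1 = int p ^ k * (c + 2 * a * s) + (int p ^ k)\<^sup>2 * s\<^sup>2"
      using c by (simp add: power2_eq_square algebra_simps)
    moreover have "int p ^ Suc k dvd int p ^ k * (c + 2 * a * s)"
      using s by (auto simp: s_def mult.commute intro: mult_dvd_mono)
    \<comment> \<open>The quadratic term carries \<open>p ^ (2 * k)\<close>, and
      \<open>k + 1 \<le> 2 * k\<close> because \<open>k \<ge> 1\<close>.\<close>
    moreover have "int p ^ Suc k dvd (int p ^ k)\<^sup>2 * s\<^sup>2"
      using Suc.hyps by (intro dvd_mult2, unfold power_mult[symmetric], intro le_imp_power_dvd) simp
    ultimately show ?case by (metis dvd_add)
  qed
qed simp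

section \<open>Solution counts for linear congruences\<close>

lemma card_residue_class:
  fixes d N c :: int
  assumes "d > 0" "d dvd N" "N \<ge> 0"
  shows "int (card {y \<in> {0..<N}. [y = c] (mod d)}) = N div d"
proof -
  from assms obtain q where q: "N = d * q" by auto
  then have q0: "q \<ge> 0" using assms by (simp add: zero_le_mult_iff)
  have "bij_betw (\<lambda>j. c mod d + d * j) {0..<q} {y \<in> {0..<N}. [y = c] (mod d)}"
  proof (rule bij_betw_byWitness[where f' = "\<lambda>y. y div d"])
    show "(\<lambda>j. c mod d + d * j) ` {0..<q} \<subseteq> {y \<in> {0..<N}. [y = c] (mod d)}"
    proof safe
      fix j assume j: "j \<in> {0..<q}"
      have "d * (j + 1) \<le> d * q" using j assms by (intro mult_left_mono) auto
      then have "c mod d + d * j < d * q"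
        using pos_mod_bound[of d c] assms by (simp add: algebra_simps del: pos_mod_bound)
      then show "c mod d + d * j \<in> {0..<N}" using assms j q by simp
      show "[c mod d + d * j = c] (mod d)" by (simp add: cong_def)
    qed
    show "(\<lambda>y. y div d) ` {y \<in> {0..<N}. [y = c] (mod d)} \<subseteq> {0..<q}"
    proof safe
      fix y assume y: "y \<in> {0..<N}"
      have "d * (y div d) \<le> y" using assms pos_mod_sign[of d y] by (simp add: mult_div_mod_eq minus_mod_eq_mult_div[symmetric])
      then have "d * (y div d) < d * q" using y q by simp
      then show "y div d \<in> {0..<q}" using assms y by (simp add: pos_imp_zdiv_nonneg_iff)
    qed
    show "\<forall>j\<in>{0..<q}. (c mod d + d * j) div d = j" using assms by simp
    show "\<forall>y\<in>{y \<in> {0..<N}. [y = c] (mod d)}. c mod d + d * (y div d) = y"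
      by (auto simp: cong_def) (metis mod_mult_div_eq)
  qed
  then have "card {y \<in> {0..<N}. [y = c] (mod d)} = card {0..<q}"
    by (rule bij_betw_same_card[symmetric])
  then show ?thesis using q q0 assms by simp
qed

text \<open>Dividing by \<open>g = gcd x d\<close> makes the coefficient invertible, so
  \<open>y\<close> is fixed modulo \<open>d div g\<close>. The range \<open>N\<close> may be a
  proper multiple of the modulus \<open>d\<close>; the two-variable count relies on this.\<close>

lemma card_linear_cong:
  fixes d N x c :: int
  assumes "d > 0" "d dvd N" "N \<ge> 0"
  shows "int (card {y \<in> {0..<N}. [x * y = c] (mod d)}) =
           (if gcd x d dvd c then N div d * gcd x d else 0)"
proof (cases "gcd x d dvd c")
  case True
  define g where "g = gcd x d"
  have g: "g > 0" using assms by (simp add: g_def)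
  obtain x' d' where xd: "x = x' * g" "d = d' * g" "coprime x' d'"
    using gcd_coprime_exists[of x d] g unfolding g_def by (metis less_irrefl)
  obtain c' where c: "c = g * c'" using True by (auto simp: g_def)
  have d': "d' > 0" using xd g assms by (simp add: zero_less_mult_iff)
  obtain r where r: "[x' * r = 1] (mod d')" using cong_solve_coprime_int xd(3) by blast
  have "[x * y = c] (mod d) \<longleftrightarrow> [y = r * c'] (mod d')" for y
  proof -
    have "[x * y = c] (mod d) \<longleftrightarrow> [g * (x' * y) = g * c'] (mod g * d')"
      unfolding xd(1,2) c by (simp only: mult_ac)
    also have "\<dots> \<longleftrightarrow> [x' * y = c'] (mod d')"
      using g unfolding cong_iff_dvd_diff right_diff_distrib[symmetric] by simp
    also have "\<dots> \<longleftrightarrow> [x' * y = x' * (r * c')] (mod d')"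
    proof -
      have "[x' * (r * c') = c'] (mod d')"
        using cong_scalar_right[OF r, of c'] by (simp add: mult.assoc)
      then show ?thesis by (meson cong_trans cong_sym)
    qed
    also have "\<dots> \<longleftrightarrow> [y = r * c'] (mod d')"
      using xd(3) by (rule cong_mult_lcancel)
    finally show ?thesis .
  qed
  moreover have "d' dvd N" using assms(2) unfolding xd(2) by (rule dvd_mult_left)
  ultimately have "int (card {y \<in> {0..<N}. [x * y = c] (mod d)}) = N div d'"
    using card_residue_class[of d' N "r * c'"] assms d' by simp
  also have "\<dots> = N div d * g"
  proof -
    obtain q where "N = d * q" using assms(2) by blast
    then have "N div d = q" using assms(1) by simp
    moreover have "N = d' * (g * q)" using \<open>N = d * q\<close> by (simp add: xd(2))
    ultimately show ?thesis using d' by simp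
  qed
  finally show ?thesis using True by (simp add: g_def)
next
  case False
  have "\<not> [x * y = c] (mod d)" for y
  proof
    assume "[x * y = c] (mod d)"
    then have "gcd x d dvd x * y - c"
      using gcd_dvd2 dvd_trans unfolding cong_iff_dvd_diff by blast
    moreover have "gcd x d dvd x * y" by simp
    ultimately have "gcd x d dvd x * y - (x * y - c)" by (rule dvd_diff[rotated])
    then show False using False by simp
  qed
  then show ?thesis using False by simp
qed

text \<open>For fixed \<open>w\<close>, the congruence in \<open>y\<close> is solvable iff
  \<open>d = gcd x n\<close> divides \<open>c - z * w\<close>, and then has \<open>d\<close>
  solutions. The admissible \<open>w\<close> in turn solve \<open>z * w = c\<close> modulo
  \<open>d\<close>, and there are \<open>n div d * gcd z d\<close> of them or none.\<close>

lemma card_linear_cong2: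
  fixes n x z c :: int
  assumes "n > 0"
  shows "int (card {(y, w) \<in> {0..<n} \<times> {0..<n}. [x * y + z * w = c] (mod n)}) =
           (if gcd z (gcd x n) dvd c then n * gcd z (gcd x n) else 0)"
proof -
  define d where "d = gcd x n"
  have d: "d > 0" "d dvd n" using assms by (auto simp: d_def)
  have "{(y, w) \<in> {0..<n} \<times> {0..<n}. [x * y + z * w = c] (mod n)} =
        prod.swap ` (SIGMA w:{0..<n}. {y \<in> {0..<n}. [x * y = c - z * w] (mod n)})"
    by (auto simp: cong_iff_dvd_diff algebra_simps image_iff)
  moreover have "finite {y \<in> {0..<n}. P y}" for P
    by (rule finite_subset[of _ "{0..<n}"]) auto
  ultimately have "int (card {(y, w) \<in> {0..<n} \<times> {0..<n}. [x * y + z * w = c] (mod n)}) =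
        (\<Sum>w\<in>{0..<n}. int (card {y \<in> {0..<n}. [x * y = c - z * w] (mod n)}))"
    by (simp only: card_image inj_swap[THEN inj_on_subset, OF subset_UNIV], subst card_SigmaI) simp_all
  also have "\<dots> = (\<Sum>w\<in>{0..<n}. if d dvd c - z * w then d else 0)"
    using assms by (intro sum.cong refl, subst card_linear_cong) (auto simp: d_def)
  also have "\<dots> = d * int (card {w \<in> {0..<n}. d dvd c - z * w})"
    by (simp add: sum.If_cases Int_def)
  also have "{w \<in> {0..<n}. d dvd c - z * w} = {w \<in> {0..<n}. [z * w = c] (mod d)}"
    by (simp add: cong_iff_dvd_diff dvd_diff_commute)
  also have "d * int (card \<dots>) = (if gcd z d dvd c then n * gcd z d else 0)"
    using card_linear_cong[of d n z c] assms d by simp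
  finally show ?thesis by (simp add: d_def)
qed

section \<open>Counting the values of the split form modulo \<open>p ^ k\<close>\<close>

lemma gcd_prime_power_ex:
  fixes p k :: nat and y :: int
  assumes "prime p"
  shows "\<exists>r\<le>k. gcd y (int p ^ k) = int p ^ r"
proof -
  have "prime (int p)" using assms by simp
  then obtain r where "r \<le> k" "normalize (gcd y (int p ^ k)) = int p ^ r"
    by (rule divides_primepow[OF _ gcd_dvd2])
  then show ?thesis by auto
qed

text \<open>Pairs with both entries divisible by \<open>p ^ s\<close> number
  \<open>p ^ (2 * (k - s))\<close>; removing those divisible by \<open>p ^ (s + 1)\<close> leaves
  the exact gcd. For \<open>s = k\<close> nothing is removed and only \<open>(0, 0)\<close> remains;
  truncated subtraction would turn the general formula into 0 there.\<close>

lemma card_pairs_gcd: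
  fixes p k s :: nat
  assumes "prime p" "s \<le> k"
  shows "int (card {(x, z) \<in> {0..<int p ^ k} \<times> {0..<int p ^ k}. gcd z (gcd x (int p ^ k)) = int p ^ s}) =
    (if s = k then 1 else int p ^ (2 * (k - s)) - int p ^ (2 * (k - s - 1)))"
proof -
  let ?I = "{0..<int p ^ k}"
  have p: "int p > 1" using assms(1) prime_gt_1_nat by simp
  define M where "M s = {(x, z) \<in> ?I \<times> ?I. int p ^ s dvd gcd z (gcd x (int p ^ k))}" for s
  have fin: "finite (M s)" for s
    unfolding M_def by (rule finite_subset[of _ "?I \<times> ?I"]) auto
  have cM: "int (card (M s)) = int p ^ (2 * (k - s))" if "s \<le> k" for s
  proof -
    have "M s = {x \<in> ?I. [x = 0] (mod int p ^ s)} \<times> {x \<in> ?I. [x = 0] (mod int p ^ s)}"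
      using that by (auto simp: M_def cong_0_iff le_imp_power_dvd)
    moreover have "int (card {x \<in> ?I. [x = 0] (mod int p ^ s)}) = int p ^ (k - s)"
      using that p by (subst card_residue_class) (auto simp: le_imp_power_dvd power_diff)
    ultimately show ?thesis by (simp add: card_cartesian_product mult_2 power_add)
  qed
  have ex: "\<exists>r\<le>k. gcd z (gcd x (int p ^ k)) = int p ^ r" for x z
    using gcd_prime_power_ex[OF assms(1), of k "gcd z x"] by (simp add: gcd.assoc)
  have pw: "int p ^ a dvd int p ^ b \<longleftrightarrow> a \<le> b" for a b
    using p by (simp add: dvd_power_iff)
  show ?thesis
  proof (cases "s = k")
    case True
    have "{(x, z) \<in> ?I \<times> ?I. gcd z (gcd x (int p ^ k)) = int p ^ s} = M k"
    proof -
      have "gcd z (gcd x (int p ^ k)) = int p ^ k \<longleftrightarrow> int p ^ k dvd gcd z (gcd x (int p ^ k))" for x z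
      proof -
        obtain r where "r \<le> k" "gcd z (gcd x (int p ^ k)) = int p ^ r" using ex by blast
        then show ?thesis using pw[of k r] p by auto
      qed
      then show ?thesis using True unfolding M_def by simp
    qed
    then show ?thesis using True cM[of k] by simp
  next
    case False
    have "{(x, z) \<in> ?I \<times> ?I. gcd z (gcd x (int p ^ k)) = int p ^ s} = M s - M (Suc s)"
    proof -
      have "gcd z (gcd x (int p ^ k)) = int p ^ s \<longleftrightarrow>
          int p ^ s dvd gcd z (gcd x (int p ^ k)) \<and> \<not> int p ^ Suc s dvd gcd z (gcd x (int p ^ k))" for x z
      proof -
        obtain r where r: "r \<le> k" "gcd z (gcd x (int p ^ k)) = int p ^ r" using ex by blast
        show ?thesis unfolding r(2) pw using p by (auto simp del: power_Suc)
      qed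
      then show ?thesis unfolding M_def by auto
    qed
    moreover have "M (Suc s) \<subseteq> M s"
      unfolding M_def by (auto intro: dvd_trans[OF le_imp_power_dvd[of s "Suc s"]] simp del: power_Suc)
    moreover from this have "int (card (M s - M (Suc s))) = int (card (M s)) - int (card (M (Suc s)))"
      using fin by (simp only: card_Diff_subset of_nat_diff card_mono)
    ultimately show ?thesis
      using False assms(2) cM[of s] cM[of "Suc s"] by simp
  qed
qed

text \<open>Assumption \<open>t\<close> describes the valuation of \<open>m\<close> capped at
  \<open>k\<close>, with \<open>t = k\<close> covering \<open>m = 0\<close>. Each pair
  \<open>(x, z)\<close> with gcd \<open>p ^ s\<close> contributes \<open>p ^ (k + s)\<close>
  solutions when \<open>s \<le> t\<close>. The pair \<open>(0, 0)\<close>, of gcd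
  \<open>p ^ k\<close>, contributes only for \<open>t = k\<close> and is kept as a separate
  summand.\<close>

lemma card_hyperbolic_form:
  fixes p k t :: nat and m :: int
  assumes "prime p" "t \<le> k" and t: "\<And>s. s \<le> k \<Longrightarrow> int p ^ s dvd m \<longleftrightarrow> s \<le> t"
  shows "int (card {(x, y, z, w). x \<in> {0..<int p ^ k} \<and> y \<in> {0..<int p ^ k} \<and> z \<in> {0..<int p ^ k}
            \<and> w \<in> {0..<int p ^ k} \<and> [x * y + z * w = m] (mod int p ^ k)}) =
    (\<Sum>s<min k (Suc t). (int p ^ (2 * (k - s)) - int p ^ (2 * (k - s - 1))) * int p ^ (k + s))
      + (if t = k then int p ^ (2 * k) else 0)"
proof -
  let ?n = "int p ^ k"
  let ?I = "{0..<?n}"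
  let ?g = "\<lambda>(x, z). gcd z (gcd x ?n)"
  have p: "int p > 1" using assms(1) prime_gt_1_nat by simp
  have "bij_betw (\<lambda>(x, y, z, w). ((x, z), (y, w)))
      {(x, y, z, w). x \<in> ?I \<and> y \<in> ?I \<and> z \<in> ?I \<and> w \<in> ?I \<and> [x * y + z * w = m] (mod ?n)}
      (SIGMA q:?I \<times> ?I. {(y, w) \<in> ?I \<times> ?I. [fst q * y + snd q * w = m] (mod ?n)})"
    by (rule bij_betw_byWitness[where f' = "\<lambda>((x, z), (y, w)). (x, y, z, w)"]) auto
  then have "int (card {(x, y, z, w). x \<in> ?I \<and> y \<in> ?I \<and> z \<in> ?I \<and> w \<in> ?I \<and> [x * y + z * w = m] (mod ?n)})
     = int (card (SIGMA q:?I \<times> ?I. {(y, w) \<in> ?I \<times> ?I. [fst q * y + snd q * w = m] (mod ?n)}))"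
    by (simp add: bij_betw_same_card)
  also have "\<dots> = (\<Sum>q\<in>?I \<times> ?I. int (card {(y, w) \<in> ?I \<times> ?I. [fst q * y + snd q * w = m] (mod ?n)}))"
  proof -
    have "finite {(y, w) \<in> ?I \<times> ?I. P y w}" for P
      by (rule finite_subset[of _ "?I \<times> ?I"]) auto
    then show ?thesis by (subst card_SigmaI) simp_all
  qed
  also have "\<dots> = (\<Sum>q\<in>?I \<times> ?I. if ?g q dvd m then ?n * ?g q else 0)"
    using p by (intro sum.cong refl, subst card_linear_cong2) (auto simp: case_prod_beta)
  \<comment> \<open>The pairs are grouped by the exponent \<open>s\<close> of their gcd, on which
    alone the summand depends.\<close>
  also have "\<dots> = (\<Sum>s\<in>{..k}. \<Sum>q\<in>{q \<in> ?I \<times> ?I. ?g q = int p ^ s}. if ?g q dvd m then ?n * ?g q else 0)"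
  proof -
    have ex: "\<exists>r\<le>k. ?g q = int p ^ r" for q
      using gcd_prime_power_ex[OF assms(1), of k "gcd (snd q) (fst q)"]
      by (simp add: gcd.assoc case_prod_beta)
    have inj: "inj_on (\<lambda>s. int p ^ s) {..k}" using p by (auto intro: inj_onI)
    have "(\<Sum>q\<in>?I \<times> ?I. if ?g q dvd m then ?n * ?g q else 0) =
        (\<Sum>v\<in>(\<lambda>s. int p ^ s) ` {..k}. \<Sum>q\<in>{q \<in> ?I \<times> ?I. ?g q = v}. if ?g q dvd m then ?n * ?g q else 0)"
      using ex by (intro sum.group[symmetric]) (auto simp: image_iff)
    then show ?thesis by (simp add: sum.reindex[OF inj])
  qed
  also have "\<dots> = (\<Sum>s\<in>{..k}. if s \<le> t then
      (if s = k then 1 else int p ^ (2 * (k - s)) - int p ^ (2 * (k - s - 1))) * int p ^ (k + s) else 0)"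
  proof (intro sum.cong refl)
    fix s assume "s \<in> {..k}"
    then have s: "s \<le> k" by simp
    have cnt: "int (card {q \<in> ?I \<times> ?I. ?g q = int p ^ s}) =
        (if s = k then 1 else int p ^ (2 * (k - s)) - int p ^ (2 * (k - s - 1)))"
    proof -
      have "{q \<in> ?I \<times> ?I. ?g q = int p ^ s} = {(x, z) \<in> ?I \<times> ?I. gcd z (gcd x ?n) = int p ^ s}"
        by auto
      then show ?thesis by (simp only: card_pairs_gcd[OF assms(1) s])
    qed
    have "(\<Sum>q\<in>{q \<in> ?I \<times> ?I. ?g q = int p ^ s}. if ?g q dvd m then ?n * ?g q else 0) =
        (\<Sum>q\<in>{q \<in> ?I \<times> ?I. ?g q = int p ^ s}. if s \<le> t then int p ^ (k + s) else 0)"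
      using t[OF s] by (intro sum.cong refl) (auto simp: power_add)
    also have "\<dots> = (if s \<le> t then int (card {q \<in> ?I \<times> ?I. ?g q = int p ^ s}) * int p ^ (k + s) else 0)"
      by simp
    finally show "(\<Sum>q\<in>{q \<in> ?I \<times> ?I. ?g q = int p ^ s}. if ?g q dvd m then ?n * ?g q else 0) =
      (if s \<le> t then
      (if s = k then 1 else int p ^ (2 * (k - s)) - int p ^ (2 * (k - s - 1))) * int p ^ (k + s) else 0)"
      unfolding cnt .
  qed
  \<comment> \<open>The term \<open>s = k\<close> is split off: one pair, weight
    \<open>p ^ (k + k)\<close>.\<close>
  also have "\<dots> = (\<Sum>s<k. if s \<le> t then
        (int p ^ (2 * (k - s)) - int p ^ (2 * (k - s - 1))) * int p ^ (k + s) else 0)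
      + (if t = k then int p ^ (2 * k) else 0)"
    unfolding lessThan_Suc_atMost[symmetric] sum.lessThan_Suc
    using assms(2) by (intro arg_cong2[where f = "(+)"] sum.cong) (auto simp: mult_2)
  also have "(\<Sum>s<k. if s \<le> t then
        (int p ^ (2 * (k - s)) - int p ^ (2 * (k - s - 1))) * int p ^ (k + s) else 0) =
      (\<Sum>s<min k (Suc t). (int p ^ (2 * (k - s)) - int p ^ (2 * (k - s - 1))) * int p ^ (k + s))"
    by (rule sum.mono_neutral_cong_right) auto
  finally show ?thesis .
qed

text \<open>The summand equals \<open>(p\<^sup>2 - 1) * p ^ (3 * k - 2 - s)\<close>, so this is a
  geometric sum with ratio \<open>1 / p\<close>; the factor \<open>p - 1\<close> is absorbed by
  \<open>1 + p + ... + p ^ j\<close>.\<close>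

lemma geometric_count:
  fixes p k j :: nat
  assumes "j < k"
  shows "(\<Sum>s<Suc j. (int p ^ (2 * (k - s)) - int p ^ (2 * (k - s - 1))) * int p ^ (k + s)) =
    int p ^ (3 * k - 2 - j) * (int p + 1) * (int p ^ (j + 1) - 1)"
  using assms
proof (induction j)
  case 0
  then obtain l where "k = Suc l" by (cases k) auto
  then show ?case by (simp add: algebra_simps power2_eq_square power_add eval_nat_numeral)
next
  case (Suc j)
  \<comment> \<open>Writing \<open>k = j + 2 + l\<close> turns every truncated subtraction in the
    exponents into an honest sum.\<close>
  then obtain l where l: "k = j + 2 + l" by (metis add_2_eq_Suc' add_Suc less_imp_Suc_add)
  have e: "3 * k - 2 - j = Suc (3 * l + 2 * j + 3)" "3 * k - 2 - Suc j = 3 * l + 2 * j + 3"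
    "k - Suc j = Suc l" "k + Suc j = 2 * j + 3 + l" "k - Suc j - 1 = l"
    using l by simp_all
  have A: "int p ^ (2 * Suc l) = int p ^ (2 * l) * int p ^ 2"
    by (simp add: power2_eq_square)
  have AB: "int p ^ (3 * l + 2 * j + 3) = int p ^ (2 * l) * int p ^ (2 * j + 3 + l)"
    by (simp add: add.assoc flip: power_add)
  \<comment> \<open>With \<open>A = p ^ (2 * l)\<close> and \<open>B = p ^ (2 * j + 3 + l)\<close>
    the induction step becomes a polynomial identity.\<close>
  have identity: "q * (A * B) * (q + 1) * (q ^ (j + 1) - 1) + (A * q\<^sup>2 - A) * B =
      A * B * (q + 1) * (q ^ (Suc j + 1) - 1)" for q A B :: int
    by (simp add: algebra_simps power2_eq_square)
  show ?case
    unfolding sum.lessThan_Suc[of _ "Suc j"] Suc.IH[OF Suc_lessD[OF Suc.prems]] e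
      power_Suc[of "int p" "3 * l + 2 * j + 3"] diff_Suc_1 A AB by (rule identity)
qed

section \<open>Reduction of four squares to the split form\<close>

text \<open>With \<open>u + v i = (a + b i) (z + w i)\<close> one has \<open>u\<^sup>2 + v\<^sup>2 =
  (a\<^sup>2 + b\<^sup>2) * (z\<^sup>2 + w\<^sup>2)\<close>, congruent to
  \<open>- (z\<^sup>2 + w\<^sup>2)\<close>. So the four squares become
  \<open>(x - u) * (x + u) + (y - v) * (y + v)\<close>, and \<open>F\<close> records these four
  factors.\<close>

lemma card_four_squares_eq_hyperbolic:
  fixes n m :: int
  assumes n: "n > 0" "odd n" and ab: "n dvd a\<^sup>2 + b\<^sup>2 + 1"
  defines "I \<equiv> {0..<n}"
  shows "card {(x, y, z, w). x \<in> I \<and> y \<in> I \<and> z \<in> I \<and> w \<in> I \<and> [x\<^sup>2 + y\<^sup>2 + z\<^sup>2 + w\<^sup>2 = m] (mod n)} =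
    card {(x, y, z, w). x \<in> I \<and> y \<in> I \<and> z \<in> I \<and> w \<in> I \<and> [x * y + z * w = m] (mod n)}"
    (is "card ?A = card ?B")
proof -
  let ?J = "I \<times> I \<times> I \<times> I"
  define F where "F = (\<lambda>(x, y, z, w).
    ((x - (a * z - b * w)) mod n, (x + (a * z - b * w)) mod n,
     (y - (a * w + b * z)) mod n, (y + (a * w + b * z)) mod n))"
  have FJ: "F ` ?J \<subseteq> ?J" using n by (auto simp: F_def I_def)
  have inj: "inj_on F ?J"
  proof (rule inj_onI)
    fix q q'
    assume h: "q \<in> ?J" "q' \<in> ?J" "F q = F q'"
    obtain x y z w where q: "q = (x, y, z, w)" by (cases q)
    obtain x' y' z' w' where q': "q' = (x', y', z', w')" by (cases q')
    have I: "x \<in> I" "y \<in> I" "z \<in> I" "w \<in> I" "x' \<in> I" "y' \<in> I" "z' \<in> I" "w' \<in> I"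
      and eq: "F (x, y, z, w) = F (x', y', z', w')"
      using h unfolding q q' by simp_all
    let ?u = "a * z - b * w" and ?v = "a * w + b * z"
    let ?u' = "a * z' - b * w'" and ?v' = "a * w' + b * z'"
    have c2: "coprime n 2" using n by simp
    have eqI: "r = r'" if "r \<in> I" "r' \<in> I" "n dvd r - r'" for r r'
      using that n by (metis I_def atLeastLessThan_iff mod_eq_dvd_iff mod_pos_pos_trivial)
    have 1: "n dvd (x - ?u) - (x' - ?u')" "n dvd (x + ?u) - (x' + ?u')"
      "n dvd (y - ?v) - (y' - ?v')" "n dvd (y + ?v) - (y' + ?v')"
      using eq by (simp_all add: F_def mod_eq_dvd_iff)
    \<comment> \<open>Sums of paired coordinates recover \<open>x\<close> and \<open>y\<close>, as 2
      is a unit modulo the odd \<open>n\<close>; then \<open>u\<close> and \<open>v\<close>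
      follow.\<close>
    have "n dvd 2 * (x - x')" using dvd_add[OF 1(1,2)] by (simp add: algebra_simps)
    then have x: "n dvd x - x'" using coprime_dvd_mult_right_iff[OF c2] by blast
    have "n dvd 2 * (y - y')" using dvd_add[OF 1(3,4)] by (simp add: algebra_simps)
    then have y: "n dvd y - y'" using coprime_dvd_mult_right_iff[OF c2] by blast
    have u: "n dvd ?u - ?u'" using dvd_diff[OF 1(2) x] by (simp add: algebra_simps)
    have v: "n dvd ?v - ?v'" using dvd_diff[OF 1(4) y] by (simp add: algebra_simps)
    \<comment> \<open>Conjugate multiplication undoes the substitution:
      \<open>a * u + b * v = (a\<^sup>2 + b\<^sup>2) * z\<close>, so the displayed number is just
      \<open>z - z'\<close>. For \<open>w\<close> the combination is
      \<open>a * v - b * u\<close>.\<close>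
    have "n dvd (a\<^sup>2 + b\<^sup>2 + 1) * (z - z') - (a * (?u - ?u') + b * (?v - ?v'))"
      by (intro dvd_diff dvd_add dvd_mult dvd_mult2 u v ab)
    then have z: "n dvd z - z'" by (simp add: algebra_simps power2_eq_square)
    have "n dvd (a\<^sup>2 + b\<^sup>2 + 1) * (w - w') - (a * (?v - ?v') - b * (?u - ?u'))"
      by (intro dvd_diff dvd_add dvd_mult dvd_mult2 u v ab)
    then have w: "n dvd w - w'" by (simp add: algebra_simps power2_eq_square)
    show "q = q'"
      unfolding q q' using eqI[of x x'] eqI[of y y'] eqI[of z z'] eqI[of w w'] I x y z w by simp
  qed
  \<comment> \<open>An injective self-map of a finite set is onto, so no explicit inverse (with its
    division by 2) has to be written down.\<close>
  have surj: "F ` ?J = ?J"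
    using FJ inj by (intro endo_inj_surj) (auto simp: I_def)
  have form: "[x\<^sup>2 + y\<^sup>2 + z\<^sup>2 + w\<^sup>2 = m] (mod n) \<longleftrightarrow>
     (case F (x, y, z, w) of (X, Y, Z, W) \<Rightarrow> [X * Y + Z * W = m] (mod n))" for x y z w
  proof -
    let ?u = "a * z - b * w" and ?v = "a * w + b * z"
    have "[(x - ?u) mod n * ((x + ?u) mod n) + (y - ?v) mod n * ((y + ?v) mod n)
        = (x - ?u) * (x + ?u) + (y - ?v) * (y + ?v)] (mod n)"
      by (intro cong_add cong_mult) (simp_all add: cong_def)
    also have "(x - ?u) * (x + ?u) + (y - ?v) * (y + ?v) =
        x\<^sup>2 + y\<^sup>2 + z\<^sup>2 + w\<^sup>2 - (a\<^sup>2 + b\<^sup>2 + 1) * (z\<^sup>2 + w\<^sup>2)"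
      by (simp add: algebra_simps power2_eq_square)
    also have "[\<dots> = x\<^sup>2 + y\<^sup>2 + z\<^sup>2 + w\<^sup>2] (mod n)"
      using ab by (simp add: cong_iff_dvd_diff)
    finally show ?thesis
      unfolding F_def prod.case by (meson cong_trans cong_sym)
  qed
  have "F ` ?A = ?B"
  proof
    show "F ` ?A \<subseteq> ?B"
    proof (rule image_subsetI)
      fix q assume q: "q \<in> ?A"
      obtain x y z w where xyzw: "q = (x, y, z, w)" by (cases q)
      have "q \<in> ?J" using q by auto
      then have FqJ: "F q \<in> ?J" by (rule subsetD[OF FJ imageI])
      obtain X Y Z W where XYZW: "F q = (X, Y, Z, W)" by (cases "F q")
      have "[x\<^sup>2 + y\<^sup>2 + z\<^sup>2 + w\<^sup>2 = m] (mod n)" using q unfolding xyzw by simp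
      then have "[X * Y + Z * W = m] (mod n)"
        unfolding form[of x y z w, folded xyzw] XYZW prod.case .
      then show "F q \<in> ?B" using FqJ unfolding XYZW by simp
    qed
    show "?B \<subseteq> F ` ?A"
    proof
      fix v assume v: "v \<in> ?B"
      obtain X Y Z W where XYZW: "v = (X, Y, Z, W)" by (cases v)
      have I: "X \<in> I" "Y \<in> I" "Z \<in> I" "W \<in> I" and h: "[X * Y + Z * W = m] (mod n)"
        using v unfolding XYZW by simp_all
      then have "(X, Y, Z, W) \<in> F ` ?J" unfolding surj by simp
      then obtain q where q: "(X, Y, Z, W) = F q" "q \<in> ?J" by (rule imageE)
      obtain x y z w where xyzw: "q = (x, y, z, w)" by (cases q)
      have "[x\<^sup>2 + y\<^sup>2 + z\<^sup>2 + w\<^sup>2 = m] (mod n)"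
        using h unfolding form[of x y z w, folded xyzw] q(1)[symmetric] prod.case .
      then have "q \<in> ?A" using q(2) unfolding xyzw by simp
      then show "v \<in> F ` ?A" unfolding XYZW q(1) by (rule imageI)
    qed
  qed
  moreover have "card (F ` ?A) = card ?A"
    by (rule card_image, rule inj_on_subset[OF inj]) auto
  ultimately show ?thesis by simp
qed

section \<open>The count for each valuation\<close>

theorem mainTheorem2:
  fixes p k t :: nat and m :: int
  assumes "prime p" and "odd p" and "k \<ge> 1"
    and "m \<in> carrier (residue_ring (int p ^ k))"
    and "t = residue_val p k m"
  shows "(t = 0 \<longrightarrow>
            int (num_quat_norm p k m) = int p ^ (3 * k - 2) * (int p ^ 2 - 1)) \<and>
         (0 < t \<and> t < k \<longrightarrow>
            int (num_quat_norm p k m) = int p ^ (3 * k - 2 - t) * (int p + 1) * (int p ^ (t + 1) - 1)) \<and>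
         (t = k \<longrightarrow>
            int (num_quat_norm p k m) = int p ^ (2 * k - 1) * (int p ^ (k + 1) + int p ^ k - 1))"
proof -
  let ?n = "int p ^ k"
  let ?I = "{0..<?n}"
  have p: "int p > 1" using assms(1) prime_gt_1_nat by simp
  have n: "?n > 1" using p assms(3) by simp
  interpret residues ?n "residue_ring ?n" using n by unfold_locales auto
  have I: "carrier (residue_ring ?n) = ?I" by (auto simp: res_carrier_eq)
  have m: "0 \<le> m" "m < ?n" using assms(4) unfolding I by auto
  have val: "int p ^ s dvd m \<longleftrightarrow> s \<le> t" if "s \<le> k" for s
    using that assms(1,5) p power_dvd_iff_le_multiplicity[of m "int p" s]
    by (auto simp: residue_val_def)
  \<comment> \<open>The default value at 0 is \<open>k\<close>, so \<open>t > k\<close> would need a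
    nonzero multiple of \<open>p ^ k\<close> below \<open>p ^ k\<close>.\<close>
  have tk: "t \<le> k"
  proof (rule ccontr)
    assume "\<not> t \<le> k"
    then have "m \<noteq> 0" "?n dvd m" using assms(5) val[of k] by (auto simp: residue_val_def)
    then show False using m zdvd_imp_le by fastforce
  qed
  have eq: "m = x [^]\<^bsub>residue_ring ?n\<^esub> (2::nat) \<oplus>\<^bsub>residue_ring ?n\<^esub> y [^]\<^bsub>residue_ring ?n\<^esub> (2::nat)
      \<oplus>\<^bsub>residue_ring ?n\<^esub> z [^]\<^bsub>residue_ring ?n\<^esub> (2::nat) \<oplus>\<^bsub>residue_ring ?n\<^esub> w [^]\<^bsub>residue_ring ?n\<^esub> (2::nat)
      \<longleftrightarrow> [x\<^sup>2 + y\<^sup>2 + z\<^sup>2 + w\<^sup>2 = m] (mod ?n)"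
    if "x \<in> ?I" "y \<in> ?I" "z \<in> ?I" "w \<in> ?I" for x y z w
    using that m pow_cong[of x 2] pow_cong[of y 2] pow_cong[of z 2] pow_cong[of w 2]
    by (auto simp:  res_add_eq cong_def mod_simps)
  obtain a b where "?n dvd a\<^sup>2 + b\<^sup>2 + 1"
    using square_sum_minus_one_mod_prime_power[OF assms(1,2)] by blast
  then have "num_quat_norm p k m = card {(x, y, z, w). x \<in> ?I \<and> y \<in> ?I \<and> z \<in> ?I \<and> w \<in> ?I
      \<and> [x * y + z * w = m] (mod ?n)}"
    using card_four_squares_eq_hyperbolic[of ?n a b m] p assms(2)
    unfolding num_quat_norm_eq_card_quadruples Let_def I
    by (simp add: eq cong: conj_cong)
  then have count: "int (num_quat_norm p k m) =
      (\<Sum>s<min k (Suc t). (int p ^ (2 * (k - s)) - int p ^ (2 * (k - s - 1))) * int p ^ (k + s))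
      + (if t = k then int p ^ (2 * k) else 0)"
    using card_hyperbolic_form[OF assms(1) tk val] by simp
  have less: "int (num_quat_norm p k m) = int p ^ (3 * k - 2 - t) * (int p + 1) * (int p ^ (t + 1) - 1)"
    if "t < k"
  proof -
    have "min k (Suc t) = Suc t" using that by simp
    then show ?thesis using that unfolding count geometric_count[OF that, symmetric] by simp
  qed
  have "int (num_quat_norm p k m) = int p ^ (2 * k - 1) * (int p ^ (k + 1) + int p ^ k - 1)" if "t = k"
  proof -
    \<comment> \<open>Here the sum stops at \<open>s = k - 1 = l\<close>, so the geometric formula
      is used with \<open>j = l\<close>, and the pair \<open>(0, 0)\<close> adds
      \<open>p ^ (2 * k)\<close>.\<close>
    obtain l where l: "k = Suc l" using assms(3) by (cases k) auto
    have e: "3 * k - 2 - l = 2 * k - 1" "2 * k = Suc (2 * k - 1)" "min k (Suc t) = Suc l"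
      using l that by auto
    have "int (num_quat_norm p k m) =
        int p ^ (2 * k - 1) * (int p + 1) * (int p ^ k - 1) + int p ^ (2 * k)"
      using geometric_count[of l k p] that l unfolding count e(3) e(1) by simp
    also have "int p ^ (2 * k) = int p ^ (2 * k - 1) * int p" by (subst e(2)) simp
    finally show ?thesis by (simp add: algebra_simps)
  qed
  moreover have "int (num_quat_norm p k m) = int p ^ (3 * k - 2) * (int p ^ 2 - 1)" if "t = 0"
  proof -
    have "t < k" using that assms(3) by simp
    then show ?thesis
      unfolding less[OF \<open>t < k\<close>] that diff_zero by (simp add: algebra_simps power2_eq_square)
  qed
  ultimately show ?thesis using less by blast
qed

end
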